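(* Let $k^+$ be a valuation ring and let $A\to B$ be a finite injective morphism of $k^+$-algebras. Suppose that $B$ is a finite type $k^+$-algebra and that $A$ is a saturated $k^+$-submodule of $B$. Then $A$ is a $k^+$-algebra of finite type.
   Context: A $k^+$-submodule $N\subset M$ is saturated in $M$ if the quotient $M/N$ is $k^+$-torsion free. Finite means that $B$ is a finite $A$-module. *)

theory Defs
  imports "HOL-Algebra.Generated_Rings" "HOL-Algebra.Module" "HOL-Algebra.QuotRing"
begin

text \<open>
  A valuation ring is given as a subring \<open>V\<close> of a field \<open>K\<close> (which is then its field of
  fractions); the ring itself is \<open>K\<lparr>carrier := V\<rparr>\<close>. The case \<open>V = carrier K\<close> is allowed.
\<close>

definition valuation_ring_of :: "'k set \<Rightarrow> ('k, 'm) ring_scheme \<Rightarrow> bool" where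
  "valuation_ring_of V K \<longleftrightarrow>
     field K \<and> subring V K \<and>
     (\<forall>x \<in> carrier K - {\<zero>\<^bsub>K\<^esub>}. x \<in> V \<or> inv\<^bsub>K\<^esub> x \<in> V)"

definition algebra_hom ::
    "('r, 'm) ring_scheme \<Rightarrow> ('r, 'a, 'n) module_scheme \<Rightarrow> ('r, 'b, 'l) module_scheme \<Rightarrow> ('a \<Rightarrow> 'b) set"
  where
  "algebra_hom R A B =
     {f \<in> ring_hom A B. \<forall>r \<in> carrier R. \<forall>x \<in> carrier A. f (r \<odot>\<^bsub>A\<^esub> x) = r \<odot>\<^bsub>B\<^esub> f x}"

definition finite_type_algebra ::
    "('r, 'm) ring_scheme \<Rightarrow> ('r, 'a, 'n) module_scheme \<Rightarrow> bool" where
  "finite_type_algebra R A \<longleftrightarrow>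
     algebra R A \<and>
     (\<exists>S. finite S \<and> S \<subseteq> carrier A \<and>
          generate_ring A ((\<lambda>r. r \<odot>\<^bsub>A\<^esub> \<one>\<^bsub>A\<^esub>) ` carrier R \<union> S) = carrier A)"

definition finite_module ::
    "('r, 'm) ring_scheme \<Rightarrow> ('r, 'a, 'n) module_scheme \<Rightarrow> bool" where
  "finite_module R M \<longleftrightarrow>
     module R M \<and>
     (\<exists>S. finite S \<and> S \<subseteq> carrier M \<and>
          (\<forall>x \<in> carrier M. \<exists>c \<in> S \<rightarrow> carrier R. x = (\<Oplus>\<^bsub>M\<^esub>s \<in> S. c s \<odot>\<^bsub>M\<^esub> s)))"

text \<open>The ring \<open>B\<close> as a module over the source of a ring homomorphism \<open>f\<close> into \<open>B\<close>.\<close>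

definition module_via :: "('a \<Rightarrow> 'b) \<Rightarrow> ('b, 'm) ring_scheme \<Rightarrow> ('a, 'b) module" where
  "module_via f B =
     \<lparr>carrier = carrier B, mult = mult B, one = one B, zero = zero B, add = add B,
      smult = (\<lambda>a b. f a \<otimes>\<^bsub>B\<^esub> b)\<rparr>"

definition finite_ring_hom ::
    "('a, 'm) ring_scheme \<Rightarrow> ('b, 'n) ring_scheme \<Rightarrow> ('a \<Rightarrow> 'b) \<Rightarrow> bool" where
  "finite_ring_hom A B f \<longleftrightarrow> f \<in> ring_hom A B \<and> finite_module A (module_via f B)"

text \<open>
  The record type of modules extends that of rings, so the quotient module needs (irrelevant)
  values for the ring multiplication and its unit; \<open>module\<close> does not refer to them.
\<close>

definition quotient_module ::
    "('r, 'a, 'n) module_scheme \<Rightarrow> 'a set \<Rightarrow> ('r, 'a set) module" where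
  "quotient_module M N =
     \<lparr>carrier = a_rcosets\<^bsub>M\<^esub> N, mult = undefined, one = undefined,
      zero = N, add = set_add M,
      smult = (\<lambda>r X. \<Union>x\<in>X. N +>\<^bsub>M\<^esub> (r \<odot>\<^bsub>M\<^esub> x))\<rparr>"

definition torsion_free_module ::
    "('r, 'm) ring_scheme \<Rightarrow> ('r, 'a, 'n) module_scheme \<Rightarrow> bool" where
  "torsion_free_module R M \<longleftrightarrow>
     (\<forall>r \<in> carrier R. \<forall>x \<in> carrier M.
        r \<odot>\<^bsub>M\<^esub> x = \<zero>\<^bsub>M\<^esub> \<longrightarrow> r = \<zero>\<^bsub>R\<^esub> \<or> x = \<zero>\<^bsub>M\<^esub>)"

definition saturated_submodule ::
    "('r, 'm) ring_scheme \<Rightarrow> ('r, 'a, 'n) module_scheme \<Rightarrow> 'a set \<Rightarrow> bool" where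
  "saturated_submodule R M N \<longleftrightarrow>
     submodule N R M \<and> torsion_free_module R (quotient_module M N)"

end

theory Submission
  imports Defs "HOL-Algebra.Divisibility" "HOL-Library.Multiset_Order"
begin

text \<open>
  As in the Artin-Tate lemma, choose finitely many \<open>b\<^sub>i \<in> A\<close> (\<open>i \<in> I\<close>), with 1 among them, and
  \<open>b\<^sub>j \<in> B\<close> (\<open>j \<in> J\<close>) such that the monomials with exactly one factor from \<open>J\<close> span \<open>B\<close> over
  the valuation ring \<open>R\<close>. Because of the factor 1, every element of \<open>B\<close> is a combination of such
  monomials of one and the same degree \<open>d\<close>, for some \<open>d\<close>. Among the combinations with value in \<open>A\<close>,
  call a monomial leading if it is the largest one with a unit coefficient, that is, if it is the
  leading monomial modulo the maximal ideal. By Dickson's lemma the leading monomials of all degrees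
  are multiples of finitely many of them, and the values of combinations with these finitely many
  leading monomials, together with the \<open>b\<^sub>i\<close>, generate \<open>A\<close>: given a combination of degree \<open>d\<close>
  with value in \<open>A\<close>, subtract multiples of such combinations until the coefficients at all
  leading positions vanish. If the remainder were nonzero, division by a coefficient of minimal
  valuation would, by saturation, give a combination with value in \<open>A\<close> and a unit coefficient,
  whose leading position contradicts the vanishing.
\<close>

lemma mono_subsequence_counts:
  fixes f :: "nat \<Rightarrow> 'i multiset"
  assumes "finite X"
  shows "\<exists>r::nat \<Rightarrow> nat. strict_mono r \<and> (\<forall>x\<in>X. \<forall>i j. i \<le> j \<longrightarrow> count (f (r i)) x \<le> count (f (r j)) x)"
  using assms
proof (induction X)
  case empty
  show ?case by (rule exI[of _ "\<lambda>n::nat. n"]) (simp add: strict_mono_def)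
next
  case (insert y X)
  then obtain r :: "nat \<Rightarrow> nat" where r: "strict_mono r"
    "\<forall>x\<in>X. \<forall>i j. i \<le> j \<longrightarrow> count (f (r i)) x \<le> count (f (r j)) x"
    by auto
  obtain s :: "nat \<Rightarrow> nat" where s: "strict_mono s" "monoseq (\<lambda>n. count (f (r (s n))) y)"
    using seq_monosub[of "\<lambda>n. count (f (r n)) y"] by blast
  have "\<exists>k. \<forall>i j. k \<le> i \<longrightarrow> i \<le> j \<longrightarrow> count (f (r (s i))) y \<le> count (f (r (s j))) y"
  proof (cases "\<forall>m n. m \<le> n \<longrightarrow> count (f (r (s m))) y \<le> count (f (r (s n))) y")
    case False
    then have dec: "\<And>m n. m \<le> n \<Longrightarrow> count (f (r (s n))) y \<le> count (f (r (s m))) y"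
      using s(2) unfolding monoseq_def by auto
    obtain k where k: "\<And>n. count (f (r (s k))) y \<le> count (f (r (s n))) y"
      using ex_has_least_nat[of "\<lambda>_. True" 0 "\<lambda>n. count (f (r (s n))) y"] by auto
    show ?thesis
      using dec k by (meson order_trans)
  qed blast
  then obtain k where
    k: "\<And>i j. k \<le> i \<Longrightarrow> i \<le> j \<Longrightarrow> count (f (r (s i))) y \<le> count (f (r (s j))) y"
    by blast
  define t where "t n = r (s (n + k))" for n
  have "strict_mono t"
    unfolding t_def using r(1) s(1) by (simp add: strict_mono_def)
  moreover have "count (f (t i)) x \<le> count (f (t j)) x" if "x \<in> insert y X" "i \<le> j" for x i j
  proof (cases "x = y")
    case True
    then show ?thesis using k[of "i + k" "j + k"] that by (simp add: t_def)
  next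
    case False
    moreover have "s (i + k) \<le> s (j + k)"
      using s(1) that by (simp add: strict_mono_less_eq)
    ultimately show ?thesis using r(2) that by (simp add: t_def)
  qed
  ultimately show ?case by blast
qed

lemma dickson_multiset:
  fixes L :: "'i multiset set"
  assumes "finite X" and sub: "\<And>q. q \<in> L \<Longrightarrow> set_mset q \<subseteq> X"
  obtains G where "finite G" "G \<subseteq> L" "\<And>q. q \<in> L \<Longrightarrow> \<exists>p\<in>G. p \<subseteq># q"
proof
  let ?G = "{q \<in> L. \<forall>p\<in>L. \<not> p \<subset># q}"
  show "?G \<subseteq> L" by blast
  show "\<exists>p\<in>?G. p \<subseteq># q" if "q \<in> L" for q
  proof -
    have "\<exists>p. (p \<in> L \<and> p \<subseteq># q) \<and> (\<forall>p'. p' \<in> L \<and> p' \<subseteq># q \<longrightarrow> size p \<le> size p')"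
      using that by (intro ex_has_least_nat[of _ q]) simp
    then obtain p where p: "p \<in> L" "p \<subseteq># q"
      "\<forall>p'. p' \<in> L \<and> p' \<subseteq># q \<longrightarrow> size p \<le> size p'"
      by (elim exE conjE)
    have "\<not> p' \<subset># p" if "p' \<in> L" for p'
    proof
      assume sub: "p' \<subset># p"
      then have "p' \<subseteq># q" using p(2) by (meson subset_mset.order_trans subset_mset.less_imp_le)
      then have "size p \<le> size p'" using p(3) that by simp
      then show False using mset_subset_size[OF sub] by simp
    qed
    then show ?thesis using p(1,2) by blast
  qed
  show "finite ?G"
  proof (rule ccontr)
    assume "infinite ?G"
    then obtain f :: "nat \<Rightarrow> 'i multiset" where f: "inj f" "range f \<subseteq> ?G"
      using infinite_countable_subset by blast
    obtain r :: "nat \<Rightarrow> nat" where r: "strict_mono r"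
      "\<forall>x\<in>X. \<forall>i j. i \<le> j \<longrightarrow> count (f (r i)) x \<le> count (f (r j)) x"
      using mono_subsequence_counts[OF assms(1)] by blast
    have fG: "f n \<in> ?G" for n using f(2) by blast
    have "count (f (r 0)) x \<le> count (f (r 1)) x" for x
    proof (cases "x \<in> X")
      case False
      then have "x \<notin># f (r 0)" using sub fG by blast
      then show ?thesis by (simp add: not_in_iff)
    qed (use r(2) in simp)
    then have "f (r 0) \<subseteq># f (r 1)" by (simp add: subseteq_mset_def)
    moreover have "f (r 0) \<noteq> f (r 1)"
      using f(1) r(1) by (metis inj_eq strict_mono_eq zero_neq_one)
    ultimately have "f (r 0) \<subset># f (r 1)" by (simp add: subset_mset.less_le)
    then show False using fG[of "r 0"] fG[of "r 1"] by blast
  qed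
qed

context module
begin

definition lincomb :: "'i set \<Rightarrow> ('i \<Rightarrow> 'a) \<Rightarrow> ('i \<Rightarrow> 'c) \<Rightarrow> 'c" where
  "lincomb P c e = (\<Oplus>\<^bsub>M\<^esub>p\<in>P. c p \<odot>\<^bsub>M\<^esub> e p)"

lemma lincomb_closed:
  "\<lbrakk>c \<in> P \<rightarrow> carrier R; e \<in> P \<rightarrow> carrier M\<rbrakk> \<Longrightarrow> lincomb P c e \<in> carrier M"
  unfolding lincomb_def by (rule M.finsum_closed) auto

lemma lincomb_add:
  assumes "c \<in> P \<rightarrow> carrier R" "c' \<in> P \<rightarrow> carrier R" "e \<in> P \<rightarrow> carrier M"
  shows "lincomb P (\<lambda>p. c p \<oplus> c' p) e = lincomb P c e \<oplus>\<^bsub>M\<^esub> lincomb P c' e"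
proof -
  have "lincomb P (\<lambda>p. c p \<oplus> c' p) e = (\<Oplus>\<^bsub>M\<^esub>p\<in>P. c p \<odot>\<^bsub>M\<^esub> e p \<oplus>\<^bsub>M\<^esub> c' p \<odot>\<^bsub>M\<^esub> e p)"
    unfolding lincomb_def using assms
    by (intro M.finsum_cong') (auto simp: Pi_iff smult_l_distr)
  also have "\<dots> = lincomb P c e \<oplus>\<^bsub>M\<^esub> lincomb P c' e"
    unfolding lincomb_def using assms by (intro M.finsum_addf) (auto simp: Pi_iff)
  finally show ?thesis .
qed

lemma lincomb_smult:
  assumes "finite P" "a \<in> carrier R" "c \<in> P \<rightarrow> carrier R" "e \<in> P \<rightarrow> carrier M"
  shows "lincomb P (\<lambda>p. a \<otimes> c p) e = a \<odot>\<^bsub>M\<^esub> lincomb P c e"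
proof -
  have "lincomb P (\<lambda>p. a \<otimes> c p) e = (\<Oplus>\<^bsub>M\<^esub>p\<in>P. a \<odot>\<^bsub>M\<^esub> (c p \<odot>\<^bsub>M\<^esub> e p))"
    unfolding lincomb_def using assms
    by (intro M.finsum_cong') (auto simp: Pi_iff smult_assoc1)
  also have "\<dots> = a \<odot>\<^bsub>M\<^esub> lincomb P c e"
    unfolding lincomb_def using assms by (intro finsum_smult_ldistr[symmetric]) (auto simp: Pi_iff)
  finally show ?thesis .
qed

lemma lincomb_zero:
  assumes "\<And>p. p \<in> P \<Longrightarrow> c p = \<zero>" "e \<in> P \<rightarrow> carrier M"
  shows "lincomb P c e = \<zero>\<^bsub>M\<^esub>"
  unfolding lincomb_def using assms by (intro M.add.finprod_one_eqI) (auto simp: Pi_iff)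

lemma lincomb_unit_vector:
  assumes "finite P" "q \<in> P" "e \<in> P \<rightarrow> carrier M"
  shows "lincomb P (\<lambda>p. if p = q then \<one> else \<zero>) e = e q"
proof -
  have "lincomb P (\<lambda>p. if p = q then \<one> else \<zero>) e = (\<Oplus>\<^bsub>M\<^esub>p\<in>P. if q = p then e p else \<zero>\<^bsub>M\<^esub>)"
    unfolding lincomb_def using assms by (intro M.finsum_cong') (auto simp: Pi_iff)
  also have "\<dots> = e q" using assms by (intro M.finsum_singleton) auto
  finally show ?thesis .
qed

lemma submodule_finsum_closed:
  assumes "submodule H R M" "\<And>p. p \<in> P \<Longrightarrow> g p \<in> H"
  shows "(\<Oplus>\<^bsub>M\<^esub>p\<in>P. g p) \<in> H"
proof -
  have z: "\<zero>\<^bsub>M\<^esub> \<in> H"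
    using subgroup.one_closed[OF submodule.axioms(1)[OF assms(1)]] by simp
  show ?thesis
  proof (cases "finite P")
    case True
    then show ?thesis using assms(2)
    proof (induction P)
      case (insert x P)
      have "g \<in> P \<rightarrow> carrier M" "g x \<in> carrier M"
        using insert.prems submoduleE(1)[OF assms(1)] by auto
      then show ?case using insert submoduleE(5)[OF assms(1)] by simp
    qed (simp add: z)
  qed (simp add: z)
qed

end

locale valuation_algebra = algebra +
  assumes divides_total:
    "\<lbrakk>x \<in> carrier R; y \<in> carrier R\<rbrakk> \<Longrightarrow> x divides\<^bsub>R\<^esub> y \<or> y divides\<^bsub>R\<^esub> x"
    and one_not_zero: "\<one> \<noteq> \<zero>"
begin

lemma zero_not_unit: "\<zero> \<notin> Units R"
  using one_not_zero by (metis R.Units_r_inv_ex R.l_null)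

lemma nonunit_mult:
  assumes "x \<in> carrier R" "y \<in> carrier R" "y \<notin> Units R"
  shows "x \<otimes> y \<notin> Units R"
  using assms R.prod_unit_r R.m_comm R.unit_factor by metis

lemma nonunit_add:
  assumes "x \<in> carrier R" "y \<in> carrier R" "x \<notin> Units R" "y \<notin> Units R"
  shows "x \<oplus> y \<notin> Units R"
proof -
  have *: "x \<oplus> y \<notin> Units R"
    if xy: "x \<in> carrier R" "x \<notin> Units R" "x divides\<^bsub>R\<^esub> y" for x y
  proof -
    obtain z where z: "z \<in> carrier R" "y = x \<otimes> z" using xy(3) by (auto simp: factor_def)
    then have "x \<oplus> y = (\<one> \<oplus> z) \<otimes> x" using xy by (simp add: R.l_distr R.m_comm[of x z])
    then show ?thesis using nonunit_mult[of "\<one> \<oplus> z" x] xy z by simp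
  qed
  show ?thesis
    using *[of x y] *[of y x] divides_total[of x y] assms by (auto simp: R.a_comm)
qed

lemma unit_add_nonunit:
  assumes "x \<in> Units R" "y \<in> carrier R" "y \<notin> Units R"
  shows "x \<oplus> y \<in> Units R"
proof (rule ccontr)
  assume "x \<oplus> y \<notin> Units R"
  moreover have "\<ominus> y \<notin> Units R"
    using nonunit_mult[of "\<ominus> \<one>" y] assms by (simp add: R.l_minus)
  moreover have x: "x \<in> carrier R" using assms by auto
  ultimately have "(x \<oplus> y) \<oplus> \<ominus> y \<notin> Units R"
    using assms nonunit_add by simp
  moreover have "(x \<oplus> y) \<oplus> \<ominus> y = x"
    using assms x by (simp add: R.a_assoc R.r_neg)
  ultimately show False using assms by simp
qed

lemma exists_dividing_all:
  assumes "finite P" "P \<noteq> {}" "c \<in> P \<rightarrow> carrier R"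
  shows "\<exists>p\<in>P. \<forall>q\<in>P. c p divides\<^bsub>R\<^esub> c q"
  using assms
proof (induction P rule: finite_ne_induct)
  case (singleton x)
  then show ?case by auto
next
  case (insert x P)
  then obtain p where p: "p \<in> P" "\<forall>q\<in>P. c p divides\<^bsub>R\<^esub> c q" by auto
  have cc: "c x \<in> carrier R" "c p \<in> carrier R" using insert.prems p by auto
  show ?case
  proof (cases "c p divides\<^bsub>R\<^esub> c x")
    case True
    then show ?thesis using p by auto
  next
    case False
    then have "c x divides\<^bsub>R\<^esub> c p" using divides_total cc by blast
    then have "\<forall>q\<in>insert x P. c x divides\<^bsub>R\<^esub> c q"
      using p cc R.divides_trans by auto
    then show ?thesis by blast
  qed
qed

text \<open>The bound on the coefficients beyond \<open>L\<close> keeps the pivot a unit in the induction step.\<close>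

lemma eliminate_leading:
  fixes P :: "'i::linorder set"
  assumes P: "finite P" and e: "e \<in> P \<rightarrow> carrier M" and H: "submodule H R M"
    and "finite L" "L \<subseteq> P"
    and "\<And>p. p \<in> L \<Longrightarrow> \<exists>g\<in>P \<rightarrow> carrier R. lincomb P g e \<in> H \<and> g p \<in> Units R \<and>
           (\<forall>q\<in>P. p < q \<longrightarrow> g q \<notin> Units R)"
    and "c \<in> P \<rightarrow> carrier R"
  shows "\<exists>u\<in>P \<rightarrow> carrier R. lincomb P u e \<in> H \<and> (\<forall>q\<in>L. c q \<oplus> u q = \<zero>) \<and>
           (\<forall>q\<in>P. (\<forall>p\<in>L. p < q) \<longrightarrow> u q \<notin> Units R)"
  using assms(4-)
proof (induction L arbitrary: c rule: finite_linorder_max_induct)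
  case empty
  have "lincomb P (\<lambda>_. \<zero>) e \<in> H"
    using lincomb_zero[of P "\<lambda>_. \<zero>" e] e subgroup.one_closed[OF submodule.axioms(1)[OF H]] by simp
  then show ?case using zero_not_unit by (intro bexI[of _ "\<lambda>_. \<zero>"]) auto
next
  case (insert b L)
  have bP: "b \<in> P" using insert.prems by simp
  obtain g where g: "g \<in> P \<rightarrow> carrier R" "lincomb P g e \<in> H" "g b \<in> Units R"
    "\<And>q. q \<in> P \<Longrightarrow> b < q \<Longrightarrow> g q \<notin> Units R"
    using insert.prems(2)[of b] by auto
  have IH: "\<exists>u\<in>P \<rightarrow> carrier R. lincomb P u e \<in> H \<and> (\<forall>q\<in>L. c q \<oplus> u q = \<zero>) \<and>
           (\<forall>q\<in>P. (\<forall>p\<in>L. p < q) \<longrightarrow> u q \<notin> Units R)" if "c \<in> P \<rightarrow> carrier R" for c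
    using insert.IH[of c] insert.prems that by auto
  obtain u where u: "u \<in> P \<rightarrow> carrier R" "lincomb P u e \<in> H" "\<And>q. q \<in> L \<Longrightarrow> c q \<oplus> u q = \<zero>"
    "\<And>q. q \<in> P \<Longrightarrow> \<forall>p\<in>L. p < q \<Longrightarrow> u q \<notin> Units R"
    using IH[OF insert.prems(3)] by auto
  obtain v where v: "v \<in> P \<rightarrow> carrier R" "lincomb P v e \<in> H" "\<And>q. q \<in> L \<Longrightarrow> g q \<oplus> v q = \<zero>"
    "\<And>q. q \<in> P \<Longrightarrow> \<forall>p\<in>L. p < q \<Longrightarrow> v q \<notin> Units R"
    using IH[OF g(1)] by auto
  define h where "h q = g q \<oplus> v q" for q
  have h: "h \<in> P \<rightarrow> carrier R" using g(1) v(1) by (auto simp: h_def Pi_iff)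
  have hH: "lincomb P h e \<in> H"
    unfolding h_def lincomb_add[OF g(1) v(1) e] using g v submoduleE(5)[OF H] by blast
  have hb: "h b \<in> Units R"
    unfolding h_def using g(3) v(1) v(4)[OF bP] insert.hyps bP by (intro unit_add_nonunit) auto
  define k where "k = \<ominus> (c b \<oplus> u b) \<otimes> inv (h b)"
  have cb: "c b \<in> carrier R" "u b \<in> carrier R" "h b \<in> carrier R"
    using insert.prems(3) u(1) h bP by auto
  have k: "k \<in> carrier R" unfolding k_def using cb hb by simp
  let ?w = "\<lambda>q. u q \<oplus> k \<otimes> h q"
  have kh: "(\<lambda>q. k \<otimes> h q) \<in> P \<rightarrow> carrier R" using k h by auto
  have "lincomb P ?w e \<in> H"
    unfolding lincomb_add[OF u(1) kh e] lincomb_smult[OF P k h e]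
    using u(2) hH k submoduleE(4,5)[OF H] by blast
  moreover have "?w \<in> P \<rightarrow> carrier R" using u(1) kh by auto
  moreover have "c q \<oplus> ?w q = \<zero>" if "q \<in> insert b L" for q
  proof (cases "q = b")
    case True
    have "k \<otimes> h b = \<ominus> (c b \<oplus> u b)"
      unfolding k_def using cb hb by (simp add: R.m_assoc)
    then show ?thesis using True cb by (simp add: R.a_assoc[symmetric] R.r_neg)
  next
    case False
    then have "q \<in> L" using that by simp
    moreover have "c q \<in> carrier R" "u q \<in> carrier R"
      using insert.prems u(1) \<open>q \<in> L\<close> by auto
    ultimately show ?thesis using u(3) v(3) k by (simp add: h_def)
  qed
  moreover have "?w q \<notin> Units R" if "q \<in> P" "\<forall>p\<in>insert b L. p < q" for q
  proof -
    have "h q \<notin> Units R" unfolding h_def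
      using that g v by (intro nonunit_add) auto
    then have "k \<otimes> h q \<notin> Units R" using k h that by (intro nonunit_mult) auto
    then show ?thesis using that u kh by (intro nonunit_add) auto
  qed
  ultimately show ?case by (intro bexI[of _ ?w]) auto
qed

definition leading_positions where
  "leading_positions P e N = {p \<in> P. \<exists>c\<in>P \<rightarrow> carrier R. lincomb P c e \<in> N \<and> c p \<in> Units R \<and>
     (\<forall>q\<in>P. p < q \<longrightarrow> c q \<notin> Units R)}"

lemma lincomb_mem_if_leading:
  fixes P :: "'i::linorder set"
  assumes P: "finite P" and e: "e \<in> P \<rightarrow> carrier M" and H: "submodule H R M"
    and N: "submodule N R M" and "H \<subseteq> N"
    and sat: "\<And>r x. \<lbrakk>r \<in> carrier R; r \<noteq> \<zero>; x \<in> carrier M; r \<odot>\<^bsub>M\<^esub> x \<in> N\<rbrakk> \<Longrightarrow> x \<in> N"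
    and lead: "leading_positions P e N \<subseteq> leading_positions P e H"
    and c: "c \<in> P \<rightarrow> carrier R" "lincomb P c e \<in> N"
  shows "lincomb P c e \<in> H"
proof -
  let ?L = "leading_positions P e N"
  have LP: "?L \<subseteq> P" by (auto simp: leading_positions_def)
  then have "finite ?L" using P finite_subset by blast
  then obtain u where u: "u \<in> P \<rightarrow> carrier R" "lincomb P u e \<in> H" "\<And>q. q \<in> ?L \<Longrightarrow> c q \<oplus> u q = \<zero>"
    using eliminate_leading[OF P e H _ LP _ c(1)] lead
    unfolding leading_positions_def by blast
  define w where "w q = c q \<oplus> u q" for q
  have w: "w \<in> P \<rightarrow> carrier R" using c(1) u(1) by (auto simp: w_def Pi_iff)
  have split: "lincomb P w e = lincomb P c e \<oplus>\<^bsub>M\<^esub> lincomb P u e"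
    unfolding w_def by (rule lincomb_add[OF c(1) u(1) e])
  then have wN: "lincomb P w e \<in> N"
    using c(2) u(2) \<open>H \<subseteq> N\<close> submoduleE(5)[OF N] by auto
  have "w q = \<zero>" if "q \<in> P" for q
  proof (rule ccontr)
    assume "w q \<noteq> \<zero>"
    have "P \<noteq> {}" using \<open>q \<in> P\<close> by auto
    from exists_dividing_all[OF P this w] obtain p where p: "p \<in> P" "\<forall>q\<in>P. w p divides\<^bsub>R\<^esub> w q" ..
    have wp: "w p \<in> carrier R" using w p by auto
    have "w p \<noteq> \<zero>" using bspec[OF p(2) that] \<open>w q \<noteq> \<zero>\<close> by (auto simp: factor_def)
    have "\<forall>q\<in>P. \<exists>z. z \<in> carrier R \<and> w q = w p \<otimes> z" using p(2) by (auto simp: factor_def)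
    from bchoice[OF this] obtain z0
      where z0: "\<forall>q\<in>P. z0 q \<in> carrier R \<and> w q = w p \<otimes> z0 q" ..
    define z where "z = z0(p := \<one>)"
    have z: "z \<in> P \<rightarrow> carrier R" "\<And>q. q \<in> P \<Longrightarrow> w q = w p \<otimes> z q"
      using z0 wp by (auto simp: z_def)
    have "lincomb P w e = lincomb P (\<lambda>q. w p \<otimes> z q) e"
      unfolding lincomb_def using z e wp
      by (intro M.finsum_cong') (auto simp: Pi_iff)
    then have "w p \<odot>\<^bsub>M\<^esub> lincomb P z e \<in> N"
      using wN lincomb_smult[OF P wp z(1) e] by simp
    then have zN: "lincomb P z e \<in> N"
      using sat[OF wp \<open>w p \<noteq> \<zero>\<close>] lincomb_closed[OF z(1) e] by blast
    let ?U = "{q \<in> P. z q \<in> Units R}"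
    have U: "finite ?U" "?U \<noteq> {}" using P p(1) by (auto simp: z_def)
    have m: "Max ?U \<in> ?U" using Max_in[OF U] .
    moreover have "z q \<notin> Units R" if "q \<in> P" "Max ?U < q" for q
      using Max_ge[OF U(1), of q] that by auto
    ultimately have "Max ?U \<in> ?L" using z(1) zN by (auto simp: leading_positions_def)
    then have "w (Max ?U) = \<zero>" unfolding w_def by (rule u(3))
    then have "w p \<otimes> z (Max ?U) = \<zero>" using m z(2) by simp
    moreover have "w p = w p \<otimes> (z (Max ?U) \<otimes> inv (z (Max ?U)))" using m wp by simp
    moreover have "\<dots> = (w p \<otimes> z (Max ?U)) \<otimes> inv (z (Max ?U))"
      using m wp by (intro R.m_assoc[symmetric]) auto
    ultimately show False using m \<open>w p \<noteq> \<zero>\<close> by simp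
  qed
  then have "lincomb P w e = \<zero>\<^bsub>M\<^esub>" using lincomb_zero e by blast
  then have "lincomb P c e = \<ominus>\<^bsub>M\<^esub> lincomb P u e"
    using split lincomb_closed[OF c(1) e] lincomb_closed[OF u(1) e]
    by (simp add: M.minus_equality M.a_comm)
  then show ?thesis using submoduleE(3)[OF H u(2)] by simp
qed

end

lemma filter_mset_eq_empty_iff: "filter_mset P q = {#} \<longleftrightarrow> (\<forall>i\<in>#q. \<not> P i)"
  by (induction q) auto

definition linear_monomials :: "'i set \<Rightarrow> 'i set \<Rightarrow> nat \<Rightarrow> 'i multiset set" where
  "linear_monomials I J d = {q \<in> multisets_of_size (I \<union> J) d. size (filter_mset (\<lambda>i. i \<in> J) q) = 1}"

lemma finite_linear_monomials: "finite I \<Longrightarrow> finite J \<Longrightarrow> finite (linear_monomials I J d)"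
  unfolding linear_monomials_def by (rule finite_subset[of _ "multisets_of_size (I \<union> J) d"]) auto

lemma linear_monomials_add:
  assumes "I \<inter> J = {}" "set_mset p \<subseteq> I" "q \<in> linear_monomials I J d"
  shows "p + q \<in> linear_monomials I J (size p + d)"
proof -
  have "filter_mset (\<lambda>i. i \<in> J) p = {#}" using assms(1,2) by (auto simp: filter_mset_eq_empty_iff)
  then show ?thesis using assms by (auto simp: linear_monomials_def multisets_of_size_def)
qed

lemma linear_monomials_diff:
  assumes "I \<inter> J = {}" "set_mset p \<subseteq> I" "q \<in> linear_monomials I J (size p + d)" "p \<subseteq># q"
  shows "q - p \<in> linear_monomials I J d"
proof -
  have "filter_mset (\<lambda>i. i \<in> J) p = {#}" using assms(1,2) by (auto simp: filter_mset_eq_empty_iff)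
  then have "filter_mset (\<lambda>i. i \<in> J) (q - p) = filter_mset (\<lambda>i. i \<in> J) q"
    by (simp only: filter_diff_mset diff_empty)
  then show ?thesis using assms
    by (auto simp: linear_monomials_def multisets_of_size_def size_Diff_submset
        simp del: filter_diff_mset dest: in_diffD)
qed

lemma linear_monomials_quotient:
  assumes "p \<in> linear_monomials I J d" "q \<in> linear_monomials I J d'" "p \<subseteq># q"
  shows "set_mset (q - p) \<subseteq> I"
proof -
  let ?F = "filter_mset (\<lambda>i. i \<in> J)"
  have "?F p \<subseteq># ?F q" using assms(3) by (rule multiset_filter_mono)
  moreover have "size (?F p) = size (?F q)" using assms by (simp add: linear_monomials_def)
  ultimately have "?F p = ?F q" by (metis mset_subset_size nat_less_le subset_mset.le_less)
  then have "?F (q - p) = {#}" by simp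
  then have "\<forall>i\<in>#q - p. i \<notin> J" unfolding filter_mset_eq_empty_iff .
  then show ?thesis using assms(2)
    by (auto simp: linear_monomials_def multisets_of_size_def dest: in_diffD)
qed

context algebra
begin

definition monomial :: "'i set \<Rightarrow> ('i \<Rightarrow> 'c) \<Rightarrow> 'i multiset \<Rightarrow> 'c" where
  "monomial X b q = (\<Otimes>\<^bsub>M\<^esub>i\<in>X. b i [^]\<^bsub>M\<^esub> count q i)"

lemma monomial_closed: "b \<in> X \<rightarrow> carrier M \<Longrightarrow> monomial X b q \<in> carrier M"
  unfolding monomial_def by (rule finprod_closed) (auto simp: Pi_iff)

lemma monomial_empty: "monomial X b {#} = \<one>\<^bsub>M\<^esub>"
  unfolding monomial_def by simp

lemma monomial_union:
  assumes "b \<in> X \<rightarrow> carrier M"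
  shows "monomial X b (p + q) = monomial X b p \<otimes>\<^bsub>M\<^esub> monomial X b q"
proof -
  have "monomial X b (p + q) =
      (\<Otimes>\<^bsub>M\<^esub>i\<in>X. b i [^]\<^bsub>M\<^esub> count p i \<otimes>\<^bsub>M\<^esub> b i [^]\<^bsub>M\<^esub> count q i)"
    unfolding monomial_def using assms
    by (intro finprod_cong') (auto simp: Pi_iff nat_pow_mult)
  also have "\<dots> = monomial X b p \<otimes>\<^bsub>M\<^esub> monomial X b q"
    unfolding monomial_def using assms by (intro finprod_multf) (auto simp: Pi_iff)
  finally show ?thesis .
qed

lemma monomial_single:
  assumes "finite X" "i \<in> X" "b \<in> X \<rightarrow> carrier M"
  shows "monomial X b {#i#} = b i"
proof -
  have "monomial X b {#i#} = (\<Otimes>\<^bsub>M\<^esub>j\<in>X. if i = j then b j else \<one>\<^bsub>M\<^esub>)"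
    unfolding monomial_def using assms
    by (intro finprod_cong') (auto simp: Pi_iff)
  also have "\<dots> = b i" using assms by (intro finprod_singleton) auto
  finally show ?thesis .
qed

lemma monomial_add_mset:
  assumes "finite X" "i \<in> X" "b \<in> X \<rightarrow> carrier M"
  shows "monomial X b (add_mset i q) = b i \<otimes>\<^bsub>M\<^esub> monomial X b q"
  using monomial_union[OF assms(3), of "{#i#}" q] monomial_single[OF assms] by simp

lemma monomial_mem_subring:
  assumes "finite X" "b \<in> X \<rightarrow> carrier M" "subring H M" "set_mset q \<subseteq> X" "b ` set_mset q \<subseteq> H"
  shows "monomial X b q \<in> H"
  using assms(4,5)
  by (induction q)
    (auto simp: monomial_empty monomial_add_mset assms(1,2) subringE(3,6)[OF assms(3)])

lemma lincomb_shift: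
  assumes fin: "finite I" "finite J" and disj: "I \<inter> J = {}" and b: "b \<in> I \<union> J \<rightarrow> carrier M"
    and p: "set_mset p \<subseteq> I" and g: "g \<in> linear_monomials I J d \<rightarrow> carrier R"
  shows "lincomb (linear_monomials I J (size p + d)) (\<lambda>q. if p \<subseteq># q then g (q - p) else \<zero>)
      (monomial (I \<union> J) b) =
    monomial (I \<union> J) b p \<otimes>\<^bsub>M\<^esub> lincomb (linear_monomials I J d) g (monomial (I \<union> J) b)"
proof -
  let ?e = "monomial (I \<union> J) b" and ?D = "linear_monomials I J"
  note e = monomial_closed[OF b]
  let ?h = "\<lambda>q. (if p \<subseteq># q then g (q - p) else \<zero>) \<odot>\<^bsub>M\<^esub> ?e q"
  have sub: "(+) p ` ?D d \<subseteq> ?D (size p + d)"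
    using linear_monomials_add[OF disj p] by auto
  have h: "?h \<in> ?D (size p + d) \<rightarrow> carrier M"
    using g e linear_monomials_diff[OF disj p] by (auto simp: Pi_iff)
  have "lincomb (?D (size p + d)) (\<lambda>q. if p \<subseteq># q then g (q - p) else \<zero>) ?e =
      (\<Oplus>\<^bsub>M\<^esub>q\<in>(+) p ` ?D d. ?h q)"
    unfolding lincomb_def
  proof (rule M.add.finprod_mono_neutral_cong_left[symmetric])
    fix q assume q: "q \<in> ?D (size p + d) - (+) p ` ?D d"
    have "\<not> p \<subseteq># q"
    proof
      assume "p \<subseteq># q"
      then have "q - p \<in> ?D d" "q = p + (q - p)"
        using linear_monomials_diff[OF disj p, of q d] q by simp_all
      then have "q \<in> (+) p ` ?D d" by (rule image_eqI[rotated])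
      then show False using q by simp
    qed
    then show "?h q = \<zero>\<^bsub>M\<^esub>" using e by simp
  qed (rule finite_linear_monomials[OF fin] sub refl h)+
  also have "\<dots> = (\<Oplus>\<^bsub>M\<^esub>q\<in>?D d. ?h (p + q))"
  proof (rule M.finsum_reindex)
    show "?h \<in> (+) p ` ?D d \<rightarrow> carrier M" using h sub by blast
    show "inj_on ((+) p) (?D d)" by (simp add: inj_on_def)
  qed
  also have "\<dots> = (\<Oplus>\<^bsub>M\<^esub>q\<in>?D d. ?e p \<otimes>\<^bsub>M\<^esub> (g q \<odot>\<^bsub>M\<^esub> ?e q))"
  proof (rule M.finsum_cong')
    fix q assume "q \<in> ?D d"
    then have gq: "g q \<in> carrier R" using g by auto
    then show "?h (p + q) = ?e p \<otimes>\<^bsub>M\<^esub> (g q \<odot>\<^bsub>M\<^esub> ?e q)"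
      using smult_assoc2[OF gq e e, of q p] m_comm[OF e e, of p q]
        m_comm[OF smult_closed[OF gq e] e, of q p]
      by (simp add: monomial_union[OF b])
  qed (use g e in \<open>auto simp: Pi_iff\<close>)
  also have "\<dots> = ?e p \<otimes>\<^bsub>M\<^esub> lincomb (?D d) g ?e"
    unfolding lincomb_def using finite_linear_monomials[OF fin] g e
    by (intro finsum_rdistr[symmetric]) (auto simp: Pi_iff)
  finally show ?thesis .
qed

lemma generate_ring_submodule:
  assumes "S \<subseteq> carrier M"
  shows "submodule (generate_ring M ((\<lambda>r. r \<odot>\<^bsub>M\<^esub> \<one>\<^bsub>M\<^esub>) ` carrier R \<union> S)) R M"
    (is "submodule ?H R M")
proof -
  have gens: "(\<lambda>r. r \<odot>\<^bsub>M\<^esub> \<one>\<^bsub>M\<^esub>) ` carrier R \<union> S \<subseteq> carrier M" using assms by auto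
  note H = generate_ring_is_subring[OF gens]
  show ?thesis
  proof (rule submoduleI)
    fix a x assume a: "a \<in> carrier R" and x: "x \<in> ?H"
    have "(a \<odot>\<^bsub>M\<^esub> \<one>\<^bsub>M\<^esub>) \<otimes>\<^bsub>M\<^esub> x \<in> ?H"
      by (rule subringE(6)[OF H _ x]) (simp add: generate_ring.incl a)
    moreover have "x \<in> carrier M" using subringE(1)[OF H] x by blast
    ultimately show "a \<odot>\<^bsub>M\<^esub> x \<in> ?H" using a smult_assoc2 by simp
  qed (use subringE[OF H] in auto)
qed

end

context valuation_algebra
begin

lemma saturated_subring_finite_type:
  fixes I J :: "'i::linorder set"
  assumes fin: "finite I" "finite J" and disj: "I \<inter> J = {}" and b: "b \<in> I \<union> J \<rightarrow> carrier M"
    and NR: "subring N M" and NM: "submodule N R M" and bI: "b ` I \<subseteq> N"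
    and sat: "\<And>r x. \<lbrakk>r \<in> carrier R; r \<noteq> \<zero>; x \<in> carrier M; r \<odot>\<^bsub>M\<^esub> x \<in> N\<rbrakk> \<Longrightarrow> x \<in> N"
    and span: "\<And>x. x \<in> N \<Longrightarrow> \<exists>d. \<exists>c\<in>linear_monomials I J d \<rightarrow> carrier R.
      x = lincomb (linear_monomials I J d) c (monomial (I \<union> J) b)"
  shows "\<exists>S. finite S \<and> S \<subseteq> N \<and> generate_ring M ((\<lambda>r. r \<odot>\<^bsub>M\<^esub> \<one>\<^bsub>M\<^esub>) ` carrier R \<union> S) = N"
proof -
  let ?D = "linear_monomials I J" and ?e = "monomial (I \<union> J) b"
  define L where "L = {q. q \<in> leading_positions (?D (size q)) ?e N}"
  have "set_mset q \<subseteq> I \<union> J" if "q \<in> L" for q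
    using that by (auto simp: L_def leading_positions_def linear_monomials_def multisets_of_size_def)
  with fin obtain G where G: "finite G" "G \<subseteq> L" "\<And>q. q \<in> L \<Longrightarrow> \<exists>p\<in>G. p \<subseteq># q"
    using dickson_multiset[of "I \<union> J" L] by (metis finite_UnI)
  have "\<forall>p\<in>G. \<exists>c. c \<in> ?D (size p) \<rightarrow> carrier R \<and> lincomb (?D (size p)) c ?e \<in> N \<and>
      c p \<in> Units R \<and> (\<forall>q\<in>?D (size p). p < q \<longrightarrow> c q \<notin> Units R)"
    using G(2) unfolding L_def leading_positions_def by blast
  from bchoice[OF this] obtain g where
    "\<forall>p\<in>G. g p \<in> ?D (size p) \<rightarrow> carrier R \<and> lincomb (?D (size p)) (g p) ?e \<in> N \<and>
      g p p \<in> Units R \<and> (\<forall>q\<in>?D (size p). p < q \<longrightarrow> g p q \<notin> Units R)" ..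
  then have g: "g p \<in> ?D (size p) \<rightarrow> carrier R" "lincomb (?D (size p)) (g p) ?e \<in> N"
      "g p p \<in> Units R" "\<forall>q\<in>?D (size p). p < q \<longrightarrow> g p q \<notin> Units R" if "p \<in> G" for p
    using that by auto
  define S where "S = b ` I \<union> (\<lambda>p. lincomb (?D (size p)) (g p) ?e) ` G"
  have SN: "S \<subseteq> N" using bI g(2) by (auto simp: S_def)
  have NM_sub: "N \<subseteq> carrier M" by (rule subringE(1)[OF NR])
  let ?gens = "(\<lambda>r. r \<odot>\<^bsub>M\<^esub> \<one>\<^bsub>M\<^esub>) ` carrier R \<union> S"
  let ?H = "generate_ring M ?gens"
  have gens: "?gens \<subseteq> N"
    using SN subringE(3)[OF NR] submoduleE(4)[OF NM] by auto
  have HR: "subring ?H M" by (rule generate_ring_is_subring) (use gens NM_sub in blast)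
  have HM: "submodule ?H R M" by (rule generate_ring_submodule) (use SN NM_sub in blast)
  have HN: "?H \<subseteq> N" by (rule generate_ring_min_subring1[OF _ NR gens]) (use gens NM_sub in blast)
  have e: "?e \<in> P \<rightarrow> carrier M" for P using monomial_closed[OF b] by simp
  have lead: "leading_positions (?D d) ?e N \<subseteq> leading_positions (?D d) ?e ?H" for d
  proof
    fix q assume q: "q \<in> leading_positions (?D d) ?e N"
    then have qD: "q \<in> ?D d" by (simp add: leading_positions_def)
    then have "size q = d" by (simp add: linear_monomials_def multisets_of_size_def)
    then have "q \<in> L" using q by (simp add: L_def)
    then obtain p where p: "p \<in> G" "p \<subseteq># q" using G(3) by blast
    define m where "m = q - p"
    have pD: "p \<in> ?D (size p)" using p(1) G(2) by (auto simp: L_def leading_positions_def)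
    have mI: "set_mset m \<subseteq> I"
      unfolding m_def by (rule linear_monomials_quotient[OF pD qD p(2)])
    have qm: "q = m + p" using p(2) by (simp add: m_def)
    then have d: "d = size m + size p" using \<open>size q = d\<close> by simp
    let ?c = "\<lambda>q. if m \<subseteq># q then g p (q - m) else \<zero>"
    have eq: "lincomb (?D d) ?c ?e = ?e m \<otimes>\<^bsub>M\<^esub> lincomb (?D (size p)) (g p) ?e"
      unfolding d by (rule lincomb_shift[OF fin disj b mI g(1)[OF p(1)]])
    have "?e m \<in> ?H"
    proof (rule monomial_mem_subring[OF _ b HR])
      show "b ` set_mset m \<subseteq> ?H" using mI by (auto simp: S_def intro!: generate_ring.incl)
    qed (use fin mI in auto)
    moreover have "lincomb (?D (size p)) (g p) ?e \<in> ?H"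
      using p(1) by (auto simp: S_def intro!: generate_ring.incl)
    ultimately have "lincomb (?D d) ?c ?e \<in> ?H" unfolding eq by (rule subringE(6)[OF HR])
    moreover have diff: "r - m \<in> ?D (size p)" if "r \<in> ?D d" "m \<subseteq># r" for r
      using linear_monomials_diff[OF disj mI _ that(2)] that(1) d by simp
    then have "?c \<in> ?D d \<rightarrow> carrier R" using g(1)[OF p(1)] by (auto simp: Pi_iff)
    moreover have "?c q \<in> Units R" using g(3)[OF p(1)] qm by simp
    moreover have "?c r \<notin> Units R" if r: "r \<in> ?D d" "q < r" for r
    proof (cases "m \<subseteq># r")
      case True
      then have "m + p < m + (r - m)" using r(2) qm by simp
      then have "p < r - m" by (simp only: add_less_cancel_left)
      then show ?thesis using True diff[OF r(1) True] g(4)[OF p(1)] by simp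
    qed (simp add: zero_not_unit)
    ultimately show "q \<in> leading_positions (?D d) ?e ?H"
      unfolding leading_positions_def using qD by (intro CollectI conjI bexI[of _ ?c]) auto
  qed
  have "x \<in> ?H" if x: "x \<in> N" for x
  proof -
    obtain d c where c: "c \<in> ?D d \<rightarrow> carrier R" "x = lincomb (?D d) c ?e"
      using span[OF x] by blast
    show ?thesis unfolding c(2)
    proof (rule lincomb_mem_if_leading[OF _ e HM NM HN sat lead c(1)])
      show "finite (?D d)" by (rule finite_linear_monomials[OF fin])
      show "lincomb (?D d) c ?e \<in> N" using x c(2) by simp
    qed
  qed
  then have "?H = N" using HN by blast
  moreover have "finite S" using fin G(1) by (simp add: S_def)
  ultimately show ?thesis using SN by blast
qed

end

context algebra
begin

lemma finite_module_span:
  fixes I J :: "'i set"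
  assumes fin: "finite I" "finite J" and disj: "I \<inter> J = {}" and b: "b \<in> I \<union> J \<rightarrow> carrier M"
    and i0: "i0 \<in> I" "b i0 = \<one>\<^bsub>M\<^esub>" and S: "S \<subseteq> carrier M"
    and one: "\<exists>k\<in>J \<rightarrow> I. \<one>\<^bsub>M\<^esub> = (\<Oplus>\<^bsub>M\<^esub>j\<in>J. b (k j) \<otimes>\<^bsub>M\<^esub> b j)"
    and mult: "\<And>s j. s \<in> S \<Longrightarrow> j \<in> J \<Longrightarrow>
      \<exists>k\<in>J \<rightarrow> I. s \<otimes>\<^bsub>M\<^esub> b j = (\<Oplus>\<^bsub>M\<^esub>j'\<in>J. b (k j') \<otimes>\<^bsub>M\<^esub> b j')"
    and x: "x \<in> generate_ring M ((\<lambda>r. r \<odot>\<^bsub>M\<^esub> \<one>\<^bsub>M\<^esub>) ` carrier R \<union> S)"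
  shows "\<exists>d. \<exists>c\<in>linear_monomials I J d \<rightarrow> carrier R.
      x = lincomb (linear_monomials I J d) c (monomial (I \<union> J) b)"
proof -
  let ?D = "linear_monomials I J" and ?e = "monomial (I \<union> J) b"
  define W where "W = {x. \<exists>d. \<exists>c\<in>?D d \<rightarrow> carrier R. x = lincomb (?D d) c ?e}"
  note finD = finite_linear_monomials[OF fin]
  note ec = monomial_closed[OF b]
  have e: "?e \<in> P \<rightarrow> carrier M" for P using ec by simp
  have WI: "lincomb (?D d) c ?e \<in> W" if "c \<in> ?D d \<rightarrow> carrier R" for c d
    using that by (auto simp: W_def)
  have raise: "\<exists>c'\<in>?D (n + d) \<rightarrow> carrier R. lincomb (?D d) c ?e = lincomb (?D (n + d)) c' ?e"
    if c: "c \<in> ?D d \<rightarrow> carrier R" for c d n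
  proof -
    let ?p = "replicate_mset n i0"
    have p: "set_mset ?p \<subseteq> I" using i0(1) by simp
    let ?c = "\<lambda>q. if ?p \<subseteq># q then c (q - ?p) else \<zero>"
    have "?e ?p = \<one>\<^bsub>M\<^esub>"
      using fin i0 b by (induction n) (simp_all add: monomial_empty monomial_add_mset)
    then have "lincomb (?D (n + d)) ?c ?e = lincomb (?D d) c ?e"
      using lincomb_shift[OF fin disj b p c] lincomb_closed[OF c e] by simp
    moreover have "?c \<in> ?D (n + d) \<rightarrow> carrier R"
      using linear_monomials_diff[OF disj p, of _ d] c by (auto simp: Pi_iff)
    ultimately show ?thesis by metis
  qed
  have W_carrier: "W \<subseteq> carrier M" using lincomb_closed[OF _ e] by (auto simp: W_def)
  have smult: "a \<odot>\<^bsub>M\<^esub> w \<in> W" if a: "a \<in> carrier R" and w: "w \<in> W" for a w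
  proof -
    obtain d c where c: "c \<in> ?D d \<rightarrow> carrier R" "w = lincomb (?D d) c ?e"
      using w by (auto simp: W_def)
    then show ?thesis
      using lincomb_smult[OF finD a c(1) e] a WI[of "\<lambda>q. a \<otimes> c q" d]
      by (auto simp: Pi_iff)
  qed
  have add: "w \<oplus>\<^bsub>M\<^esub> w' \<in> W" if w: "w \<in> W" and w': "w' \<in> W" for w w'
  proof -
    obtain d c where c: "c \<in> ?D d \<rightarrow> carrier R" "w = lincomb (?D d) c ?e"
      using w by (auto simp: W_def)
    obtain d' c' where c': "c' \<in> ?D d' \<rightarrow> carrier R" "w' = lincomb (?D d') c' ?e"
      using w' by (auto simp: W_def)
    obtain u where u: "u \<in> ?D (d + d') \<rightarrow> carrier R" "w = lincomb (?D (d + d')) u ?e"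
      using raise[OF c(1), of d'] c(2) by (auto simp: add.commute)
    obtain u' where u': "u' \<in> ?D (d + d') \<rightarrow> carrier R" "w' = lincomb (?D (d + d')) u' ?e"
      using raise[OF c'(1), of d] c'(2) by auto
    have "w \<oplus>\<^bsub>M\<^esub> w' = lincomb (?D (d + d')) (\<lambda>q. u q \<oplus> u' q) ?e"
      unfolding u(2) u'(2) by (rule lincomb_add[OF u(1) u'(1) e, symmetric])
    then show ?thesis using u(1) u'(1) WI[of "\<lambda>q. u q \<oplus> u' q" "d + d'"] by (auto simp: Pi_iff)
  qed
  have W: "submodule W R M"
  proof (rule submoduleI[OF W_carrier])
    show "\<zero>\<^bsub>M\<^esub> \<in> W"
      using WI[of "\<lambda>_. \<zero>" 0] lincomb_zero[of "?D 0" "\<lambda>_. \<zero>", OF _ e] by simp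
    fix a assume "a \<in> W"
    then show "\<ominus>\<^bsub>M\<^esub> a \<in> W" using smult[of "\<ominus> \<one>" a] W_carrier by (auto simp: smult_l_minus)
  qed (use add smult in auto)
  have eW: "?e q \<in> W" if q: "q \<in> ?D d" for q d
    using WI[of "\<lambda>p. if p = q then \<one> else \<zero>" d] lincomb_unit_vector[OF finD q e] by auto
  have single: "{#j#} \<in> ?D 1" if "j \<in> J" for j
    using that by (simp add: linear_monomials_def multisets_of_size_def)
  have sum_eW: "(\<Oplus>\<^bsub>M\<^esub>j\<in>J. b (k j) \<otimes>\<^bsub>M\<^esub> b j) \<otimes>\<^bsub>M\<^esub> ?e p \<in> W"
    if k: "k \<in> J \<rightarrow> I" and p: "set_mset p \<subseteq> I" for k p
  proof -
    have bc: "b (k j) \<in> carrier M" "b j \<in> carrier M" if "j \<in> J" for j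
      using k b that by (auto simp: Pi_iff)
    have "(\<Oplus>\<^bsub>M\<^esub>j\<in>J. b (k j) \<otimes>\<^bsub>M\<^esub> b j) \<otimes>\<^bsub>M\<^esub> ?e p = (\<Oplus>\<^bsub>M\<^esub>j\<in>J. (b (k j) \<otimes>\<^bsub>M\<^esub> b j) \<otimes>\<^bsub>M\<^esub> ?e p)"
      using fin bc ec by (intro finsum_ldistr) auto
    moreover have "(b (k j) \<otimes>\<^bsub>M\<^esub> b j) \<otimes>\<^bsub>M\<^esub> ?e p \<in> W" if j: "j \<in> J" for j
    proof -
      have kj: "k j \<in> I" using k j by auto
      have "(b (k j) \<otimes>\<^bsub>M\<^esub> b j) \<otimes>\<^bsub>M\<^esub> ?e p = ?e (add_mset (k j) (add_mset j p))"
        using fin b kj j bc[OF j] ec by (simp add: monomial_add_mset m_assoc)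
      moreover have "add_mset (k j) p + {#j#} \<in> ?D (size (add_mset (k j) p) + 1)"
        using p kj by (intro linear_monomials_add[OF disj _ single[OF j]]) auto
      ultimately show ?thesis using eW by (simp add: add_mset_commute)
    qed
    ultimately show ?thesis
      using submodule_finsum_closed[OF W, of J "\<lambda>j. (b (k j) \<otimes>\<^bsub>M\<^esub> b j) \<otimes>\<^bsub>M\<^esub> ?e p"] by simp
  qed
  have SW: "s \<otimes>\<^bsub>M\<^esub> w \<in> W" if s: "s \<in> S" and w: "w \<in> W" for s w
  proof -
    have sM: "s \<in> carrier M" using s S by blast
    obtain d c where c: "c \<in> ?D d \<rightarrow> carrier R" "w = lincomb (?D d) c ?e"
      using w by (auto simp: W_def)
    have "s \<otimes>\<^bsub>M\<^esub> w = (\<Oplus>\<^bsub>M\<^esub>q\<in>?D d. s \<otimes>\<^bsub>M\<^esub> (c q \<odot>\<^bsub>M\<^esub> ?e q))"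
      unfolding c(2) lincomb_def using finD sM c(1) ec by (intro finsum_rdistr) (auto simp: Pi_iff)
    moreover have "s \<otimes>\<^bsub>M\<^esub> (c q \<odot>\<^bsub>M\<^esub> ?e q) \<in> W" if q: "q \<in> ?D d" for q
    proof -
      have cq: "c q \<in> carrier R" using c(1) q by auto
      have "size (filter_mset (\<lambda>i. i \<in> J) q) = 1" using q by (simp add: linear_monomials_def)
      then have "filter_mset (\<lambda>i. i \<in> J) q \<noteq> {#}" by (metis size_empty zero_neq_one)
      then obtain j where j: "j \<in># q" "j \<in> J" by (auto simp: filter_mset_eq_empty_iff)
      define p where "p = q - {#j#}"
      have qp: "q = add_mset j p" using j by (simp add: p_def)
      have pI: "set_mset p \<subseteq> I"
        using linear_monomials_quotient[OF single[OF j(2)] q] j(1) by (simp add: p_def)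
      have jM: "b j \<in> carrier M" using b j by auto
      obtain k where k: "k \<in> J \<rightarrow> I" "s \<otimes>\<^bsub>M\<^esub> b j = (\<Oplus>\<^bsub>M\<^esub>j'\<in>J. b (k j') \<otimes>\<^bsub>M\<^esub> b j')"
        using mult[OF s j(2)] by blast
      have "s \<otimes>\<^bsub>M\<^esub> ?e q = (s \<otimes>\<^bsub>M\<^esub> b j) \<otimes>\<^bsub>M\<^esub> ?e p"
        unfolding qp using fin j(2) b sM jM ec by (simp add: monomial_add_mset m_assoc)
      then have "s \<otimes>\<^bsub>M\<^esub> ?e q \<in> W" using sum_eW[OF k(1) pI] k(2) by simp
      moreover have "s \<otimes>\<^bsub>M\<^esub> (c q \<odot>\<^bsub>M\<^esub> ?e q) = c q \<odot>\<^bsub>M\<^esub> (s \<otimes>\<^bsub>M\<^esub> ?e q)"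
        using smult_assoc2[OF cq ec sM] m_comm[OF sM ec] m_comm[OF sM smult_closed[OF cq ec]]
        by simp
      ultimately show ?thesis using smult[OF cq] by simp
    qed
    ultimately show ?thesis
      using submodule_finsum_closed[OF W, of "?D d" "\<lambda>q. s \<otimes>\<^bsub>M\<^esub> (c q \<odot>\<^bsub>M\<^esub> ?e q)"] by simp
  qed
  have "x \<in> carrier M \<and> (\<forall>w\<in>W. x \<otimes>\<^bsub>M\<^esub> w \<in> W)"
    using x
  proof (induction rule: generate_ring.induct)
    case one
    then show ?case using W_carrier by auto
  next
    case (incl h)
    have "(r \<odot>\<^bsub>M\<^esub> \<one>\<^bsub>M\<^esub>) \<otimes>\<^bsub>M\<^esub> w \<in> W" if "r \<in> carrier R" "w \<in> W" for r w
    proof -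
      have "w \<in> carrier M" using that(2) W_carrier by blast
      then show ?thesis using smult[OF that] that(1) by (simp add: smult_assoc2)
    qed
    then show ?case using incl S SW by auto
  next
    case (a_inv h)
    then show ?case using submoduleE(3)[OF W] W_carrier by (auto simp: l_minus)
  next
    case (eng_add h1 h2)
    then show ?case using add W_carrier by (auto simp: l_distr subset_iff)
  next
    case (eng_mult h1 h2)
    then show ?case using W_carrier by (auto simp: m_assoc subset_iff)
  qed
  moreover have "\<one>\<^bsub>M\<^esub> \<in> W"
  proof -
    obtain k where k: "k \<in> J \<rightarrow> I" "\<one>\<^bsub>M\<^esub> = (\<Oplus>\<^bsub>M\<^esub>j\<in>J. b (k j) \<otimes>\<^bsub>M\<^esub> b j)"
      using one by blast
    have "\<one>\<^bsub>M\<^esub> \<otimes>\<^bsub>M\<^esub> ?e {#} \<in> W"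
      using sum_eW[OF k(1), of "{#}"] unfolding k(2)[symmetric] by simp
    then show ?thesis by (simp add: monomial_empty)
  qed
  ultimately have "x \<in> carrier M" "x \<otimes>\<^bsub>M\<^esub> \<one>\<^bsub>M\<^esub> \<in> W" by blast+
  then have "x \<in> W" by simp
  then show ?thesis by (simp add: W_def)
qed

end

lemma (in module) saturated_submoduleD:
  assumes sat: "saturated_submodule R M N" and r: "r \<in> carrier R" "r \<noteq> \<zero>"
    and x: "x \<in> carrier M" "r \<odot>\<^bsub>M\<^esub> x \<in> N"
  shows "x \<in> N"
proof -
  have N: "submodule N R M" using sat by (simp add: saturated_submodule_def)
  note NM = submoduleE(1)[OF N]
  have sub: "subgroup N (add_monoid M)" by (rule submodule.axioms(1)[OF N])
  let ?X = "N +>\<^bsub>M\<^esub> x"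
  have xX: "x \<in> ?X" using M.add.rcos_self[OF _ sub] x(1) by (simp add: a_r_coset_def)
  have "N +>\<^bsub>M\<^esub> (r \<odot>\<^bsub>M\<^esub> y) = N" if "y \<in> ?X" for y
  proof -
    obtain n where n: "n \<in> N" "y = n \<oplus>\<^bsub>M\<^esub> x"
      using \<open>y \<in> ?X\<close> by (auto simp: a_r_coset_def r_coset_def)
    then have "r \<odot>\<^bsub>M\<^esub> y = r \<odot>\<^bsub>M\<^esub> n \<oplus>\<^bsub>M\<^esub> r \<odot>\<^bsub>M\<^esub> x"
      using NM r(1) x(1) by (auto intro: smult_r_distr)
    also have "\<dots> \<in> N" using submoduleE(4,5)[OF N] n(1) r(1) x(2) by simp
    finally show ?thesis using M.a_coset_join2[OF _ sub] NM by blast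
  qed
  then have "r \<odot>\<^bsub>quotient_module M N\<^esub> ?X = \<zero>\<^bsub>quotient_module M N\<^esub>"
    using xX by (auto simp: quotient_module_def)
  moreover have "?X \<in> carrier (quotient_module M N)"
    using M.a_rcosetsI[OF NM x(1)] by (simp add: quotient_module_def)
  moreover have "torsion_free_module R (quotient_module M N)"
    using sat by (simp add: saturated_submodule_def)
  ultimately have "?X = \<zero>\<^bsub>quotient_module M N\<^esub>"
    using r unfolding torsion_free_module_def by blast
  then have "?X = N" by (simp add: quotient_module_def)
  then show ?thesis using xX by simp
qed

lemma finsum_module_via: "finsum (module_via f B) g T = finsum B g T"
  by (simp add: finsum_def finprod_def module_via_def)

lemma finite_ring_homE:
  assumes "finite_ring_hom A B f"
  obtains T where "finite T" "T \<subseteq> carrier B"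
    "\<forall>x\<in>carrier B. \<exists>c\<in>T \<rightarrow> carrier A. x = (\<Oplus>\<^bsub>B\<^esub>t\<in>T. f (c t) \<otimes>\<^bsub>B\<^esub> t)"
  using assms unfolding finite_ring_hom_def finite_module_def finsum_module_via
  by (auto simp: module_via_def)

lemma (in ring_hom_ring) generate_ring_image_subset:
  assumes "X \<subseteq> carrier R"
  shows "generate_ring S (h ` X) \<subseteq> h ` generate_ring R X"
proof
  fix y assume "y \<in> generate_ring S (h ` X)"
  then show "y \<in> h ` generate_ring R X"
  proof (induction rule: generate_ring.induct)
    case one
    show ?case by (rule image_eqI[of _ _ "\<one>\<^bsub>R\<^esub>"]) (simp_all add: generate_ring.one)
  next
    case (incl y)
    then show ?case by (auto intro: generate_ring.incl)
  next
    case (a_inv y)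
    then obtain x where x: "x \<in> generate_ring R X" "y = h x" by blast
    then have "x \<in> carrier R" using R.generate_ring_in_carrier[OF assms] by blast
    with x show ?case by (intro image_eqI[of _ _ "\<ominus>\<^bsub>R\<^esub> x"]) (auto intro: generate_ring.a_inv)
  next
    case (eng_add y1 y2)
    then obtain x1 x2 where x: "x1 \<in> generate_ring R X" "y1 = h x1" "x2 \<in> generate_ring R X" "y2 = h x2"
      by blast
    then have "x1 \<in> carrier R" "x2 \<in> carrier R"
      using R.generate_ring_in_carrier[OF assms] by blast+
    with x show ?case
      by (intro image_eqI[of _ _ "x1 \<oplus>\<^bsub>R\<^esub> x2"]) (auto intro: generate_ring.eng_add)
  next
    case (eng_mult y1 y2)
    then obtain x1 x2 where x: "x1 \<in> generate_ring R X" "y1 = h x1" "x2 \<in> generate_ring R X" "y2 = h x2"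
      by blast
    then have "x1 \<in> carrier R" "x2 \<in> carrier R"
      using R.generate_ring_in_carrier[OF assms] by blast+
    with x show ?case
      by (intro image_eqI[of _ _ "x1 \<otimes>\<^bsub>R\<^esub> x2"]) (auto intro: generate_ring.eng_mult)
  qed
qed

lemma valuation_ring_divides_total:
  assumes "valuation_ring_of V K" "x \<in> V" "y \<in> V"
  shows "x divides\<^bsub>K\<lparr>carrier := V\<rparr>\<^esub> y \<or> y divides\<^bsub>K\<lparr>carrier := V\<rparr>\<^esub> x"
proof -
  interpret K: field K using assms(1) by (simp add: valuation_ring_of_def)
  have V: "subring V K" using assms(1) by (simp add: valuation_ring_of_def)
  note VK = subringE(1)[OF V]
  have xy: "x \<in> carrier K" "y \<in> carrier K" using assms VK by auto
  show ?thesis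
  proof (cases "x = \<zero>\<^bsub>K\<^esub> \<or> y = \<zero>\<^bsub>K\<^esub>")
    case True
    then show ?thesis
      using xy subringE(2)[OF V] assms(2,3) by (auto simp: factor_def intro!: bexI[of _ "\<zero>\<^bsub>K\<^esub>"])
  next
    case False
    then have U: "x \<in> Units K" "y \<in> Units K" using xy by (auto simp: K.field_Units)
    let ?z = "inv\<^bsub>K\<^esub> x \<otimes>\<^bsub>K\<^esub> y"
    have z: "?z \<in> Units K" using U by simp
    have inv_z: "inv\<^bsub>K\<^esub> ?z = inv\<^bsub>K\<^esub> y \<otimes>\<^bsub>K\<^esub> x"
    proof -
      have "?z \<otimes>\<^bsub>K\<^esub> (inv\<^bsub>K\<^esub> y \<otimes>\<^bsub>K\<^esub> x) = (inv\<^bsub>K\<^esub> x \<otimes>\<^bsub>K\<^esub> x) \<otimes>\<^bsub>K\<^esub> (y \<otimes>\<^bsub>K\<^esub> inv\<^bsub>K\<^esub> y)"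
        using xy U K.Units_inv_closed by (simp add: K.m_ac del: K.Units_r_inv K.Units_l_inv)
      then have "?z \<otimes>\<^bsub>K\<^esub> (inv\<^bsub>K\<^esub> y \<otimes>\<^bsub>K\<^esub> x) = \<one>\<^bsub>K\<^esub>" using U by simp
      then show ?thesis using xy U z by (intro K.comm_inv_char) auto
    qed
    have "?z \<in> V \<or> inv\<^bsub>K\<^esub> ?z \<in> V"
      using assms(1) z by (auto simp: valuation_ring_of_def K.field_Units)
    moreover have "y = x \<otimes>\<^bsub>K\<^esub> ?z" "x = y \<otimes>\<^bsub>K\<^esub> (inv\<^bsub>K\<^esub> y \<otimes>\<^bsub>K\<^esub> x)"
      using xy U by (simp_all add: K.m_assoc[symmetric])
    ultimately show ?thesis unfolding inv_z factor_def by auto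
  qed
qed

theorem lemma2p2p3:
  fixes K :: "('k, 'm) ring_scheme"
    and V :: "'k set"
    and A :: "('k, 'a, 'n) module_scheme"
    and B :: "('k, 'b, 'l) module_scheme"
    and f :: "'a \<Rightarrow> 'b"
  assumes "valuation_ring_of V K"
    and "algebra (K\<lparr>carrier := V\<rparr>) A"
    and "algebra (K\<lparr>carrier := V\<rparr>) B"
    and "f \<in> algebra_hom (K\<lparr>carrier := V\<rparr>) A B"
    and "inj_on f (carrier A)"
    and "finite_ring_hom A B f"
    and "finite_type_algebra (K\<lparr>carrier := V\<rparr>) B"
    and "saturated_submodule (K\<lparr>carrier := V\<rparr>) B (f ` carrier A)"
  shows "finite_type_algebra (K\<lparr>carrier := V\<rparr>) A"
proof -
  let ?R = "K\<lparr>carrier := V\<rparr>" and ?N = "f ` carrier A"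
  interpret K: field K using assms(1) by (simp add: valuation_ring_of_def)
  interpret A: algebra ?R A by (rule assms(2))
  interpret B: valuation_algebra ?R B
  proof (intro valuation_algebra.intro valuation_algebra_axioms.intro assms(3))
    show "x divides\<^bsub>?R\<^esub> y \<or> y divides\<^bsub>?R\<^esub> x" if "x \<in> carrier ?R" "y \<in> carrier ?R" for x y
      using valuation_ring_divides_total[OF assms(1)] that by simp
  qed simp
  have f: "f \<in> ring_hom A B"
    and f_smult: "\<And>r x. r \<in> V \<Longrightarrow> x \<in> carrier A \<Longrightarrow> f (r \<odot>\<^bsub>A\<^esub> x) = r \<odot>\<^bsub>B\<^esub> f x"
    using assms(4) by (auto simp: algebra_hom_def)
  have rA: "ring A" and rB: "ring B" using A.M_cring B.M_cring by (simp_all add: cring.axioms(1))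
  interpret f: ring_hom_ring A B f by (rule ring_hom_ringI2[OF rA rB f])
  have NR: "subring ?N B" by (rule f.img_is_subring[OF ring.carrier_is_subring[OF rA]])
  note NB = subringE(1)[OF NR]
  have NM: "submodule ?N ?R B" using assms(8) by (simp add: saturated_submodule_def)
  obtain S where S: "finite S" "S \<subseteq> carrier B"
    "generate_ring B ((\<lambda>r. r \<odot>\<^bsub>B\<^esub> \<one>\<^bsub>B\<^esub>) ` carrier ?R \<union> S) = carrier B"
    using assms(7) by (auto simp: finite_type_algebra_def)
  obtain T where T: "finite T" "T \<subseteq> carrier B"
    "\<forall>x\<in>carrier B. \<exists>c\<in>T \<rightarrow> carrier A. x = (\<Oplus>\<^bsub>B\<^esub>t\<in>T. f (c t) \<otimes>\<^bsub>B\<^esub> t)"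
    by (rule finite_ring_homE[OF assms(6)])
  define Z where "Z = insert \<one>\<^bsub>B\<^esub> ((\<lambda>(s, t). s \<otimes>\<^bsub>B\<^esub> t) ` (S \<times> T))"
  have Z: "finite Z" "Z \<subseteq> carrier B" using S T by (auto simp: Z_def)
  have "\<forall>z\<in>Z. \<exists>c. c \<in> T \<rightarrow> carrier A \<and> z = (\<Oplus>\<^bsub>B\<^esub>t\<in>T. f (c t) \<otimes>\<^bsub>B\<^esub> t)"
    using T(3) Z(2) by blast
  from bchoice[OF this] obtain c where
    c: "\<forall>z\<in>Z. c z \<in> T \<rightarrow> carrier A \<and> z = (\<Oplus>\<^bsub>B\<^esub>t\<in>T. f (c z t) \<otimes>\<^bsub>B\<^esub> t)" ..
  define C where "C = insert \<one>\<^bsub>B\<^esub> ((\<lambda>(z, t). f (c z t)) ` (Z \<times> T))"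
  have C: "finite C" "C \<subseteq> ?N" using c Z(1) T(1) subringE(3)[OF NR] by (auto simp: C_def Pi_iff)
  obtain xs where xs: "set xs = C" using finite_list[OF C(1)] by blast
  obtain ys where ys: "set ys = T" "distinct ys" using finite_distinct_list[OF T(1)] by blast
  define b where "b = (!) (xs @ ys)"
  let ?I = "{..<length xs}" and ?J = "{length xs..<length xs + length ys}"
  have bI: "b ` ?I = C"
    using xs by (auto simp: b_def nth_append set_conv_nth)
  have bJ: "bij_betw b ?J T"
  proof -
    have "bij_betw ((!) ys \<circ> (\<lambda>j. j - length xs)) ?J T"
    proof (rule bij_betw_trans)
      show "bij_betw (\<lambda>j. j - length xs) ?J {..<length ys}"
        by (rule bij_betw_byWitness[of _ "\<lambda>j. j + length xs"]) auto
      show "bij_betw ((!) ys) {..<length ys} T"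
        using bij_betw_nth[OF ys(2) refl] ys(1) by simp
    qed
    then show ?thesis by (rule bij_betw_cong[THEN iffD1, rotated]) (auto simp: b_def nth_append)
  qed
  have b: "b \<in> ?I \<union> ?J \<rightarrow> carrier B"
    using bI bij_betw_imp_surj_on[OF bJ] C(2) NB T(2) by blast
  have expand: "\<exists>k\<in>?J \<rightarrow> ?I. z = (\<Oplus>\<^bsub>B\<^esub>j\<in>?J. b (k j) \<otimes>\<^bsub>B\<^esub> b j)" if z: "z \<in> Z" for z
  proof -
    have cz: "c z \<in> T \<rightarrow> carrier A" "z = (\<Oplus>\<^bsub>B\<^esub>t\<in>T. f (c z t) \<otimes>\<^bsub>B\<^esub> t)" using c z by auto
    have bT: "b j \<in> T" if "j \<in> ?J" for j using bij_betwE[OF bJ] that by blast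
    have "\<forall>j\<in>?J. \<exists>i. i \<in> ?I \<and> f (c z (b j)) = b i"
    proof
      fix j assume "j \<in> ?J"
      then have "f (c z (b j)) \<in> C" using bT z by (auto simp: C_def)
      then show "\<exists>i. i \<in> ?I \<and> f (c z (b j)) = b i" unfolding bI[symmetric] by blast
    qed
    from bchoice[OF this] obtain k where k: "\<forall>j\<in>?J. k j \<in> ?I \<and> f (c z (b j)) = b (k j)" ..
    have fT: "(\<lambda>t. f (c z t) \<otimes>\<^bsub>B\<^esub> t) \<in> T \<rightarrow> carrier B" using cz(1) T(2) by (auto simp: Pi_iff)
    have "z = (\<Oplus>\<^bsub>B\<^esub>t\<in>b ` ?J. f (c z t) \<otimes>\<^bsub>B\<^esub> t)"
      using cz(2) bij_betw_imp_surj_on[OF bJ] by simp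
    also have "\<dots> = (\<Oplus>\<^bsub>B\<^esub>j\<in>?J. f (c z (b j)) \<otimes>\<^bsub>B\<^esub> b j)"
      using fT bij_betw_imp_surj_on[OF bJ] bij_betw_imp_inj_on[OF bJ]
      by (intro B.M.finsum_reindex) simp_all
    also have "\<dots> = (\<Oplus>\<^bsub>B\<^esub>j\<in>?J. b (k j) \<otimes>\<^bsub>B\<^esub> b j)"
      using k b by (intro B.M.finsum_cong') (auto simp: Pi_iff)
    finally show ?thesis using k by (intro bexI[of _ k]) auto
  qed
  have "\<one>\<^bsub>B\<^esub> \<in> b ` ?I" unfolding bI by (simp add: C_def)
  then obtain i0 where i0: "i0 \<in> ?I" "b i0 = \<one>\<^bsub>B\<^esub>" by auto
  have disj: "?I \<inter> ?J = {}" by auto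
  have "\<exists>S'. finite S' \<and> S' \<subseteq> ?N \<and>
      generate_ring B ((\<lambda>r. r \<odot>\<^bsub>B\<^esub> \<one>\<^bsub>B\<^esub>) ` carrier ?R \<union> S') = ?N"
  proof (rule B.saturated_subring_finite_type[OF _ _ disj b NR NM])
    show "b ` ?I \<subseteq> ?N" using bI C(2) by simp
    show "x \<in> ?N" if "r \<in> carrier ?R" "r \<noteq> \<zero>\<^bsub>?R\<^esub>" "x \<in> carrier B" "r \<odot>\<^bsub>B\<^esub> x \<in> ?N" for r x
      using B.saturated_submoduleD[OF assms(8) that] .
    fix x assume "x \<in> ?N"
    then have x: "x \<in> generate_ring B ((\<lambda>r. r \<odot>\<^bsub>B\<^esub> \<one>\<^bsub>B\<^esub>) ` carrier ?R \<union> S)"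
      unfolding S(3) using NB by blast
    show "\<exists>d. \<exists>c\<in>linear_monomials ?I ?J d \<rightarrow> carrier ?R.
        x = B.lincomb (linear_monomials ?I ?J d) c (B.monomial (?I \<union> ?J) b)"
    proof (rule B.finite_module_span[OF _ _ disj b i0 S(2) _ _ x])
      show "\<exists>k\<in>?J \<rightarrow> ?I. \<one>\<^bsub>B\<^esub> = (\<Oplus>\<^bsub>B\<^esub>j\<in>?J. b (k j) \<otimes>\<^bsub>B\<^esub> b j)"
        by (rule expand) (simp add: Z_def)
      show "\<exists>k\<in>?J \<rightarrow> ?I. s \<otimes>\<^bsub>B\<^esub> b j = (\<Oplus>\<^bsub>B\<^esub>j'\<in>?J. b (k j') \<otimes>\<^bsub>B\<^esub> b j')"
        if "s \<in> S" "j \<in> ?J" for s j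
        using bij_betwE[OF bJ] that by (intro expand) (auto simp: Z_def)
    qed simp_all
  qed simp_all
  then obtain S' where S': "finite S'" "S' \<subseteq> ?N"
    "generate_ring B ((\<lambda>r. r \<odot>\<^bsub>B\<^esub> \<one>\<^bsub>B\<^esub>) ` carrier ?R \<union> S') = ?N"
    by blast
  obtain U where U: "U \<subseteq> carrier A" "finite U" "S' = f ` U"
    using finite_subset_image[OF S'(1,2)] by blast
  let ?X = "(\<lambda>r. r \<odot>\<^bsub>A\<^esub> \<one>\<^bsub>A\<^esub>) ` carrier ?R \<union> U"
  have X: "?X \<subseteq> carrier A" using U(1) A.smult_closed by auto
  have "(\<lambda>r. f (r \<odot>\<^bsub>A\<^esub> \<one>\<^bsub>A\<^esub>)) ` V = (\<lambda>r. r \<odot>\<^bsub>B\<^esub> \<one>\<^bsub>B\<^esub>) ` V"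
    by (rule image_cong) (simp_all add: f_smult)
  then have fX: "f ` ?X = (\<lambda>r. r \<odot>\<^bsub>B\<^esub> \<one>\<^bsub>B\<^esub>) ` carrier ?R \<union> S'"
    by (simp add: U(3) image_Un image_image)
  have XA: "generate_ring A ?X \<subseteq> carrier A" by (rule ring.generate_ring_incl[OF rA X])
  have "f ` carrier A \<subseteq> f ` generate_ring A ?X"
    using f.generate_ring_image_subset[OF X] unfolding fX S'(3) .
  then have "carrier A \<subseteq> generate_ring A ?X"
    using inj_on_image_mem_iff[OF assms(5) _ XA] by blast
  with XA have "generate_ring A ?X = carrier A" by blast
  then show ?thesis
    using assms(2) U(1,2) unfolding finite_type_algebra_def by blast
qed

end
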